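(* (i) Let $\mathcal G=(\mathcal V,\mathcal E,\mathbf W)$ be an undirected weighted graph on $n$ nodes with at least one edge of positive weight, let $\mathbf L$ be its graph Laplacian, $c=1/\mathrm{trace}(\mathbf L)$, $\mathbf L_c=c\mathbf L$, and let $\lambda_1,\dots,\lambda_n$ be the eigenvalues of $\mathbf L_c$. Let $V=-\sum_{i=1}^n\lambda_i\log\lambda_i$ be the von Neumann graph entropy of $\mathcal G$, and let $Q=-\sum_{i=1}^n\lambda_i(\lambda_i-1)$ be its quadratic approximation. Then $$Q = 1-c^2\left(\mathbf d^T\mathbf d+\mathbf 1^T(\mathbf W\circ\mathbf W)\mathbf 1\right),$$ where $\mathbf d\in\mathbb R^n$ is the vector of diagonal entries of $\mathbf L$, $\mathbf 1\in\mathbb R^n$ is the all-ones vector and $\circ$ is the entrywise product. (ii) Consider a sequence of such graphs indexed by the number of nodes $n$, with associated quantities $V=V(n)$ and $Q=Q(n)$. Let $n_+$ denote the number of positive eigenvalues of $\mathbf L_c$, and let $\lambda_{\max}$ and $\lambda_{\min}$ denote the largest and the smallest nonzero eigenvalues of $\mathbf L_c$, respectively (all depending on $n$). If $n_+\sim n$ and $\lambda_{\max}\sim\lambda_{\min}$ as $n\to\infty$, then $$\lim_{n\to\infty}\left(\frac{V}{\log n}-Q\right)=0.$$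
   Context: An undirected weighted graph $\mathcal G=(\mathcal V,\mathcal E,\mathbf W)$ has node set $\mathcal V$ with $|\mathcal V|=n$, edge set $\mathcal E$, and a symmetric weight matrix $\mathbf W\in\mathbb R^{n\times n}$ with nonnegative entries such that $W_{ij}=0$ whenever $i=j$ or $(i,j)\notin\mathcal E$. Its graph Laplacian is $\mathbf L=\mathbf D-\mathbf W$, where $\mathbf D=\mathrm{diag}(\mathbf W\mathbf 1)$ is the diagonal degree matrix. The scaled Laplacian $\mathbf L_c=c\mathbf L$ with $c=1/\mathrm{trace}(\mathbf L)$ has nonnegative eigenvalues summing to $1$. The von Neumann graph entropy (VNGE) is $V=-\sum_{i=1}^n\lambda_i\log\lambda_i$, where $\lambda_1,\dots,\lambda_n$ are the eigenvalues of $\mathbf L_c$, $\log$ is the natural logarithm, and $0\log 0=0$ by convention. The quadratic approximation $Q$ of $V$ is the quantity obtained by replacing $\log\lambda_i$ in $V$ by its first-order Taylor polynomial $\lambda_i-1$ at the point $1$, i.e. $Q=-\sum_{i=1}^n\lambda_i(\lambda_i-1)$. For functions $f(n)$ and $g(n)\neq 0$, $f(n)\sim g(n)$ means $\lim_{n\to\infty}f(n)/g(n)=1$. *)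

theory Defs
  imports
    Complex_Main
    "HOL-Library.Landau_Symbols"
    "Jordan_Normal_Form.Char_Poly"
begin

text \<open>
  The nodes of a graph on \<open>n\<close> nodes are \<open>0, \<dots>, n - 1\<close>, so that they index the rows and columns
  of the weight matrix. An undirected edge is represented by both of its ordered pairs.
\<close>

definition weighted_graph :: "nat \<Rightarrow> (nat \<times> nat) set \<Rightarrow> real mat \<Rightarrow> bool" where
  "weighted_graph n E W \<longleftrightarrow>
     E \<subseteq> {0..<n} \<times> {0..<n} \<and> sym E \<and>
     W \<in> carrier_mat n n \<and> transpose_mat W = W \<and>
     (\<forall>i<n. \<forall>j<n. W $$ (i, j) \<ge> 0) \<and>
     (\<forall>i<n. \<forall>j<n. i = j \<or> (i, j) \<notin> E \<longrightarrow> W $$ (i, j) = 0)"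

definition has_positive_edge :: "(nat \<times> nat) set \<Rightarrow> real mat \<Rightarrow> bool" where
  "has_positive_edge E W \<longleftrightarrow> (\<exists>(i, j)\<in>E. W $$ (i, j) > 0)"

definition ones_vec :: "nat \<Rightarrow> real vec" where
  "ones_vec n = vec n (\<lambda>_. 1)"

definition diag_vec :: "real mat \<Rightarrow> real vec" where
  "diag_vec A = vec (dim_row A) (\<lambda>i. A $$ (i, i))"

definition mat_trace :: "real mat \<Rightarrow> real" where
  "mat_trace A = (\<Sum>i<dim_row A. A $$ (i, i))"

definition hadamard :: "real mat \<Rightarrow> real mat \<Rightarrow> real mat" where
  "hadamard A B = mat (dim_row A) (dim_col A) (\<lambda>(i, j). A $$ (i, j) * B $$ (i, j))"

definition degree_mat :: "real mat \<Rightarrow> real mat" where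
  "degree_mat W = mat_diag (dim_row W) (\<lambda>i. (W *\<^sub>v ones_vec (dim_col W)) $ i)"

definition laplacian :: "real mat \<Rightarrow> real mat" where
  "laplacian W = degree_mat W - W"

definition laplacian_scale :: "real mat \<Rightarrow> real" where
  "laplacian_scale W = 1 / mat_trace (laplacian W)"

definition scaled_laplacian :: "real mat \<Rightarrow> real mat" where
  "scaled_laplacian W = laplacian_scale W \<cdot>\<^sub>m laplacian W"

text \<open>
  The real eigenvalues, repeated according to their algebraic multiplicity. For a symmetric
  \<open>n \<times> n\<close> matrix these are all \<open>n\<close> of its eigenvalues.
\<close>

definition eigenvalue_mset :: "real mat \<Rightarrow> real multiset" where
  "eigenvalue_mset A = proots (char_poly A)"

lemma set_eigenvalue_mset:
  assumes "A \<in> carrier_mat n n"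
  shows "set_mset (eigenvalue_mset A) = {x. eigenvalue A x}"
proof -
  have "char_poly A \<noteq> 0"
    using degree_monic_char_poly[OF assms] by auto
  then show ?thesis
    by (simp add: eigenvalue_mset_def eigenvalue_root_char_poly[OF assms])
qed

abbreviation laplacian_eigenvalues :: "real mat \<Rightarrow> real multiset" where
  "laplacian_eigenvalues W \<equiv> eigenvalue_mset (scaled_laplacian W)"

text \<open>The product makes the summand vanish at \<open>x = 0\<close>, as required by the convention \<open>0 log 0 = 0\<close>.\<close>

definition von_neumann_entropy :: "real mat \<Rightarrow> real" where
  "von_neumann_entropy W = - (\<Sum>x\<in>#laplacian_eigenvalues W. x * ln x)"

definition quadratic_entropy :: "real mat \<Rightarrow> real" where
  "quadratic_entropy W = - (\<Sum>x\<in>#laplacian_eigenvalues W. x * (x - 1))"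

definition num_positive_eigenvalues :: "real mat \<Rightarrow> nat" where
  "num_positive_eigenvalues W = size {#x \<in># laplacian_eigenvalues W. x > 0#}"

definition lambda_max :: "real mat \<Rightarrow> real" where
  "lambda_max W = Max {x. x \<in># laplacian_eigenvalues W \<and> x \<noteq> 0}"

definition lambda_min :: "real mat \<Rightarrow> real" where
  "lambda_min W = Min {x. x \<in># laplacian_eigenvalues W \<and> x \<noteq> 0}"

end

theory Submission
  imports Defs "Jordan_Normal_Form.Schur_Decomposition" "HOL-Real_Asymp.Real_Asymp"
begin

text \<open>
  A symmetric real matrix \<open>A\<close> has only real eigenvalues, so Schur triangularization applies over the
  reals; the eigenvalues then sum to the trace of \<open>A\<close> and their squares to the trace of \<open>A A\<close>. For
  the scaled Laplacian these are \<open>1\<close> and \<open>c\<^sup>2\<close> times the sum of the squared entries of \<open>L\<close>, which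
  gives (i).

  For (ii), put \<open>m = n\<^sub>+\<close> and \<open>r = \<lambda>\<^sub>m\<^sub>a\<^sub>x / \<lambda>\<^sub>m\<^sub>i\<^sub>n \<longlonglongrightarrow> 1\<close>. As the eigenvalues sum to \<open>1\<close>, every nonzero one
  lies between \<open>1 / (m r)\<close> and \<open>r / m\<close>, so that \<open>\<bar>V - ln m\<bar> \<le> ln r\<close> and \<open>1 - r / m \<le> Q \<le> 1\<close>. Hence
  \<open>V / ln n\<close> and \<open>Q\<close> both tend to \<open>1\<close>. This uses only that the nonzero eigenvalues are eventually
  positive, which needs no semidefiniteness: \<open>\<lambda>\<^sub>m\<^sub>a\<^sub>x > 0\<close> because the sum is \<open>1\<close>, and \<open>r \<longlonglongrightarrow> 1\<close> eventually
  forces \<open>\<lambda>\<^sub>m\<^sub>i\<^sub>n > 0\<close>.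
\<close>

section \<open>Real spectrum of symmetric real matrices\<close>

lemma conjugate_of_real_mult_mat_vec:
  assumes A: "A \<in> carrier_mat n n" and v: "v \<in> carrier_vec n"
  shows "conjugate (map_mat complex_of_real A *\<^sub>v v) = map_mat complex_of_real A *\<^sub>v conjugate v"
proof (rule eq_vecI)
  fix i assume "i < dim_vec (map_mat complex_of_real A *\<^sub>v conjugate v)"
  with A have i: "i < n" by simp
  have "conjugate (row (map_mat complex_of_real A) i) = row (map_mat complex_of_real A) i"
    using A i by (intro eq_vecI) auto
  moreover have "conjugate (row (map_mat complex_of_real A) i \<bullet> v)
      = conjugate (row (map_mat complex_of_real A) i) \<bullet> conjugate v"
    using A v i by (intro conjugate_sprod_vec[of _ n]) auto
  ultimately show "conjugate (map_mat complex_of_real A *\<^sub>v v) $ i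
      = (map_mat complex_of_real A *\<^sub>v conjugate v) $ i"
    using A i by simp
qed (use A in simp)

text \<open>For an eigenvector \<open>v\<close>, symmetry moves the matrix to the other factor of
  \<open>v \<bullet>c v\<close>, and real entries let it pass through the conjugation. So
  \<open>a\<close> and \<open>cnj a\<close> give the same multiple of the nonzero number
  \<open>v \<bullet>c v\<close>.\<close>

lemma symmetric_real_mat_eigenvalue_real:
  assumes A: "A \<in> carrier_mat n n" and sym: "transpose_mat A = A"
    and ev: "eigenvalue (map_mat complex_of_real A) a"
  shows "a \<in> \<real>"
proof -
  define C where "C = map_mat complex_of_real A"
  have C: "C \<in> carrier_mat n n"
    using A by (simp add: C_def)
  have "transpose_mat C = map_mat complex_of_real (transpose_mat A)"
    unfolding C_def by (intro eq_matI) auto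
  then have CT: "transpose_mat C = C"
    by (simp add: C_def sym)
  from ev obtain v where v: "v \<in> carrier_vec n" and v0: "v \<noteq> 0\<^sub>v n" and Cv: "C *\<^sub>v v = a \<cdot>\<^sub>v v"
    using C unfolding eigenvalue_def eigenvector_def C_def by auto
  have "a * (v \<bullet>c v) = (C *\<^sub>v v) \<bullet>c v"
    using v by (simp add: Cv)
  also have "\<dots> = v \<bullet> (C *\<^sub>v conjugate v)"
    using transpose_vec_mult_scalar[OF C, of "conjugate v" v] C v CT by simp
  also have "\<dots> = v \<bullet>c (C *\<^sub>v v)"
    unfolding C_def by (simp add: conjugate_of_real_mult_mat_vec[OF A v])
  also have "\<dots> = cnj a * (v \<bullet>c v)"
    using v by (simp add: Cv conjugate_smult_vec)
  finally have "a = cnj a"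
    using v v0 by simp
  then show ?thesis
    by (simp add: Reals_cnj_iff)
qed

text \<open>The characteristic polynomial splits over the complex numbers with only real roots. Each
  linear factor is then the image of a real one, and the factorization descends because the
  embedding of polynomials is injective.\<close>

lemma symmetric_real_mat_char_poly_splits:
  assumes A: "(A :: real mat) \<in> carrier_mat n n" and sym: "transpose_mat A = A"
  obtains es where "char_poly A = (\<Prod>e\<leftarrow>es. [:- e, 1:])"
proof -
  interpret hom: map_poly_inj_comm_ring_hom complex_of_real ..
  let ?C = "map_mat complex_of_real A"
  have C: "?C \<in> carrier_mat n n" using A by simp
  obtain as where as: "char_poly ?C = (\<Prod>a\<leftarrow>as. [:- a, 1:])"
    using char_poly_factorized[OF C] by blast
  have "set as \<subseteq> \<real>"
  proof
    fix a assume "a \<in> set as"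
    then have "poly (char_poly ?C) a = 0"
      unfolding as by (rule linear_poly_root)
    then show "a \<in> \<real>"
      using symmetric_real_mat_eigenvalue_real[OF A sym] eigenvalue_root_char_poly[OF C] by blast
  qed
  then have as_Re: "map complex_of_real (map Re as) = as"
    by (induction as) auto
  have "map_poly complex_of_real (char_poly A) = char_poly ?C"
    by (rule of_real_hom.char_poly_hom[OF A, symmetric])
  also have "\<dots> = (\<Prod>a\<leftarrow>map complex_of_real (map Re as). [:- a, 1:])"
    by (simp only: as as_Re)
  also have "\<dots> = map_poly complex_of_real (\<Prod>e\<leftarrow>map Re as. [:- e, 1:])"
    by (induction as)
      (simp_all add: hom.hom_mult map_poly_pCons del: mult_pCons_left mult_pCons_right)
  finally have "char_poly A = (\<Prod>e\<leftarrow>map Re as. [:- e, 1:])"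
    by (simp only: hom.eq_iff)
  then show thesis by (rule that)
qed

lemma proots_prod_list_linear:
  "proots (\<Prod>e\<leftarrow>es. [:- e, 1:]) = mset (es :: 'a :: idom list)"
proof (induction es)
  case (Cons e es)
  have "(\<Prod>e\<leftarrow>es. [:- e, 1:]) \<noteq> 0"
    by (auto simp: prod_list_zero_iff)
  then show ?case
    using Cons by (simp add: proots_mult del: mult_pCons_left)
qed simp

section \<open>Traces and power sums of eigenvalues\<close>

lemma mat_trace_mult_comm:
  assumes "A \<in> carrier_mat n m" "B \<in> carrier_mat m n"
  shows "mat_trace (A * B) = mat_trace (B * A)"
proof -
  have "mat_trace (A * B) = (\<Sum>i<n. \<Sum>j<m. A $$ (i, j) * B $$ (j, i))"
    using assms by (simp add: mat_trace_def scalar_prod_def atLeast0LessThan)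
  also have "\<dots> = (\<Sum>j<m. \<Sum>i<n. B $$ (j, i) * A $$ (i, j))"
    by (subst sum.swap) (simp add: mult.commute)
  also have "\<dots> = mat_trace (B * A)"
    using assms by (simp add: mat_trace_def scalar_prod_def atLeast0LessThan)
  finally show ?thesis .
qed

text \<open>Write \<open>A = P * B * Q\<close>, move \<open>Q\<close> to the front by cyclicity of
  the trace, and cancel \<open>Q * P\<close>.\<close>

lemma mat_trace_similar:
  assumes "similar_mat_wit A B P Q"
  shows "mat_trace A = mat_trace B"
proof -
  define n where "n = dim_row A"
  note w = similar_mat_witD[OF n_def assms]
  have "mat_trace A = mat_trace (Q * (P * B))"
    unfolding w(3) by (rule mat_trace_mult_comm[of _ n n]) (use w in auto)
  also have "Q * (P * B) = Q * P * B"
    using w by (intro assoc_mult_mat[symmetric, of _ n n _ n _ n]) auto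
  also have "\<dots> = B"
    using w by simp
  finally show ?thesis .
qed

lemma mat_trace_square_upper_triangular:
  assumes B: "B \<in> carrier_mat n n" and "upper_triangular B"
  shows "mat_trace (B * B) = (\<Sum>i<n. (B $$ (i, i))\<^sup>2)"
proof -
  have "(\<Sum>j<n. B $$ (i, j) * B $$ (j, i)) = (B $$ (i, i))\<^sup>2" if "i < n" for i
  proof -
    \<comment> \<open>For \<open>i \<noteq> j\<close>, one of the two factors lies strictly below
      the diagonal and vanishes.\<close>
    have "B $$ (i, j) * B $$ (j, i) = (if j = i then (B $$ (i, i))\<^sup>2 else 0)" if "j < n" for j
      using upper_triangularD[OF assms(2), of i j] upper_triangularD[OF assms(2), of j i]
        B \<open>i < n\<close> that by (cases i j rule: linorder_cases) (auto simp: power2_eq_square)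
    then show ?thesis using that by simp
  qed
  then show ?thesis
    using B by (simp add: mat_trace_def scalar_prod_def atLeast0LessThan)
qed

lemma symmetric_real_mat_eigenvalue_sums:
  assumes A: "A \<in> carrier_mat n n" and sym: "transpose_mat A = A"
  shows "(\<Sum>x\<in>#eigenvalue_mset A. x) = mat_trace A"
    and "(\<Sum>x\<in>#eigenvalue_mset A. x\<^sup>2) = mat_trace (A * A)"
proof -
  obtain es where es: "char_poly A = (\<Prod>e\<leftarrow>es. [:- e, 1:])"
    using symmetric_real_mat_char_poly_splits[OF A sym] .
  obtain B P Q where schur: "schur_decomposition A es = (B, P, Q)"
    by (cases "schur_decomposition A es")
  from schur_decomposition[OF A es schur]
  have sim: "similar_mat_wit A B P Q" and tri: "upper_triangular B" and diag: "diag_mat B = es"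
    by auto
  have B: "B \<in> carrier_mat n n" using similar_mat_witD2[OF A sim] by simp
  have mset: "eigenvalue_mset A = mset es"
    unfolding eigenvalue_mset_def es by (rule proots_prod_list_linear)
  have sums: "(\<Sum>x\<leftarrow>es. f x) = (\<Sum>i<n. f (B $$ (i, i)))" for f :: "real \<Rightarrow> real"
    unfolding diag[symmetric] using B
    by (simp add: diag_mat_def comp_def interv_sum_list_conv_sum_set_nat atLeast0LessThan)
  show "(\<Sum>x\<in>#eigenvalue_mset A. x) = mat_trace A"
    using sums[of "\<lambda>x. x"] B
    by (simp add: mset mat_trace_similar[OF sim] mat_trace_def[of B] flip: sum_mset_sum_list)
  \<comment> \<open>The witnesses that triangularize \<open>A\<close> also conjugate
    \<open>A * A\<close> to \<open>B * B\<close>, so the trace of the square is read off the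
    diagonal of \<open>B\<close>.\<close>
  have "similar_mat_wit (A * A) (B * B) P Q"
    using similar_mat_wit_pow[OF sim, of 2] A B by (simp add: numeral_2_eq_2)
  then have "mat_trace (A * A) = (\<Sum>i<n. (B $$ (i, i))\<^sup>2)"
    using mat_trace_similar mat_trace_square_upper_triangular[OF B tri] by metis
  then show "(\<Sum>x\<in>#eigenvalue_mset A. x\<^sup>2) = mat_trace (A * A)"
    using sums[of "\<lambda>x. x\<^sup>2"] by (simp add: mset flip: sum_mset_sum_list mset_map)
qed

section \<open>Traces of the graph Laplacian and of its square\<close>

lemma laplacian_carrier: "W \<in> carrier_mat n n \<Longrightarrow> laplacian W \<in> carrier_mat n n"
  by (auto simp: laplacian_def)

lemma laplacian_index:
  assumes "W \<in> carrier_mat n n" "i < n" "j < n"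
  shows "laplacian W $$ (i, j) = (if i = j then \<Sum>k<n. W $$ (i, k) else 0) - W $$ (i, j)"
  using assms
  by (auto simp: laplacian_def degree_mat_def mat_diag_def ones_vec_def scalar_prod_def
      atLeast0LessThan)

lemma laplacian_symmetric:
  assumes W: "W \<in> carrier_mat n n" and sym: "transpose_mat W = W"
  shows "transpose_mat (laplacian W) = laplacian W"
proof -
  have "W $$ (i, j) = W $$ (j, i)" if "i < n" "j < n" for i j
    using W sym that by (metis carrier_matD index_transpose_mat(1))
  then show ?thesis
    using laplacian_carrier[OF W]
    by (intro eq_matI) (auto simp: laplacian_index[OF W])
qed

lemma mat_trace_laplacian:
  assumes "weighted_graph n E W"
  shows "mat_trace (laplacian W) = (\<Sum>i<n. \<Sum>j<n. W $$ (i, j))"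
proof -
  have W: "W \<in> carrier_mat n n" using assms by (simp add: weighted_graph_def)
  have "W $$ (i, i) = 0" if "i < n" for i
    using assms that by (simp add: weighted_graph_def)
  then show ?thesis
    using laplacian_carrier[OF W]
    by (simp add: mat_trace_def laplacian_index[OF W])
qed

text \<open>Ensures that \<open>laplacian_scale\<close> is a genuine reciprocal and not the default
  value of \<open>1 / 0\<close>, so that scaling normalizes the trace to 1.\<close>

lemma mat_trace_laplacian_pos:
  assumes G: "weighted_graph n E W" and e: "has_positive_edge E W"
  shows "mat_trace (laplacian W) > 0"
proof -
  obtain i j where ij: "(i, j) \<in> E" "W $$ (i, j) > 0"
    using e by (auto simp: has_positive_edge_def)
  with G have "i < n" "j < n" by (auto simp: weighted_graph_def)
  have nn: "W $$ (k, l) \<ge> 0" if "k < n" "l < n" for k l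
    using G that by (simp add: weighted_graph_def)
  have "(\<Sum>l<n. W $$ (i, l)) > 0"
    using \<open>i < n\<close> \<open>j < n\<close> ij nn by (intro sum_pos2[where i = j]) auto
  then have "(\<Sum>k<n. \<Sum>l<n. W $$ (k, l)) > 0"
    using \<open>i < n\<close> nn by (intro sum_pos2[where i = i and f = "\<lambda>k. \<Sum>l<n. W $$ (k, l)"])
      (auto intro: sum_nonneg)
  then show ?thesis
    by (simp add: mat_trace_laplacian[OF G])
qed

lemma mat_trace_smult: "mat_trace (c \<cdot>\<^sub>m A) = c * mat_trace A" if "A \<in> carrier_mat n n"
  using that by (simp add: mat_trace_def sum_distrib_left)

lemma mat_trace_laplacian_square:
  assumes G: "weighted_graph n E W"
  defines "d \<equiv> diag_vec (laplacian W)" and "u \<equiv> ones_vec n"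
  shows "mat_trace (laplacian W * laplacian W) = d \<bullet> d + u \<bullet> (hadamard W W *\<^sub>v u)"
proof -
  have W: "W \<in> carrier_mat n n" and sym: "transpose_mat W = W"
    and W0: "\<And>i. i < n \<Longrightarrow> W $$ (i, i) = 0"
    using G by (auto simp: weighted_graph_def)
  let ?L = "laplacian W"
  note L = laplacian_carrier[OF W]
  have L_sym: "?L $$ (i, j) = ?L $$ (j, i)" if "i < n" "j < n" for i j
    using laplacian_symmetric[OF W sym] L that by (metis carrier_matD index_transpose_mat(1))
  have "mat_trace (?L * ?L) = (\<Sum>i<n. \<Sum>j<n. ?L $$ (i, j) * ?L $$ (j, i))"
    using L by (simp add: mat_trace_def scalar_prod_def atLeast0LessThan)
  \<comment> \<open>By symmetry each summand is the square of an entry of \<open>?L\<close>. Off the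
    diagonal that entry is \<open>- W $$ (i, j)\<close>; on the diagonal the extra term
    \<open>(W $$ (i, i))\<^sup>2\<close> is zero.\<close>
  also have "\<dots> = (\<Sum>i<n. \<Sum>j<n. (if i = j then (?L $$ (i, i))\<^sup>2 else 0) + (W $$ (i, j))\<^sup>2)"
  proof (intro sum.cong refl)
    fix i j assume "i \<in> {..<n}" "j \<in> {..<n}"
    then have "i < n" "j < n" by auto
    then show "?L $$ (i, j) * ?L $$ (j, i)
        = (if i = j then (?L $$ (i, i))\<^sup>2 else 0) + (W $$ (i, j))\<^sup>2"
      unfolding L_sym[OF \<open>j < n\<close> \<open>i < n\<close>]
      by (auto simp: laplacian_index[OF W] W0 power2_eq_square)
  qed
  also have "\<dots> = (\<Sum>i<n. (?L $$ (i, i))\<^sup>2) + (\<Sum>i<n. \<Sum>j<n. (W $$ (i, j))\<^sup>2)"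
    by (simp add: sum.distrib)
  also have "(\<Sum>i<n. (?L $$ (i, i))\<^sup>2) = d \<bullet> d"
    using L by (simp add: d_def diag_vec_def scalar_prod_def atLeast0LessThan power2_eq_square)
  also have "(\<Sum>i<n. \<Sum>j<n. (W $$ (i, j))\<^sup>2) = u \<bullet> (hadamard W W *\<^sub>v u)"
    using W by (simp add: u_def ones_vec_def hadamard_def scalar_prod_def atLeast0LessThan
        power2_eq_square)
  finally show ?thesis .
qed

section \<open>Eigenvalue sums of the scaled Laplacian and the quadratic approximation\<close>

lemma scaled_laplacian_eigenvalue_sums:
  assumes G: "weighted_graph n E W" and e: "has_positive_edge E W"
  shows "(\<Sum>x\<in>#laplacian_eigenvalues W. x) = 1"
    and "(\<Sum>x\<in>#laplacian_eigenvalues W. x\<^sup>2)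
      = (laplacian_scale W)\<^sup>2 * mat_trace (laplacian W * laplacian W)"
proof -
  have W: "W \<in> carrier_mat n n" and sym: "transpose_mat W = W"
    using G by (auto simp: weighted_graph_def)
  let ?L = "laplacian W" and ?S = "scaled_laplacian W" and ?c = "laplacian_scale W"
  note L = laplacian_carrier[OF W]
  have S: "?S \<in> carrier_mat n n"
    using L by (simp add: scaled_laplacian_def)
  have "transpose_mat ?S = ?S"
    using laplacian_symmetric[OF W sym] L unfolding scaled_laplacian_def
    by (intro eq_matI) (auto, metis carrier_matD index_transpose_mat(1))
  note sums = symmetric_real_mat_eigenvalue_sums[OF S this]
  show "(\<Sum>x\<in>#laplacian_eigenvalues W. x) = 1"
    using sums(1) mat_trace_laplacian_pos[OF G e]
    by (simp add: scaled_laplacian_def mat_trace_smult[OF L] laplacian_scale_def)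
  have "?S * ?S = (?c * ?c) \<cdot>\<^sub>m (?L * ?L)"
    using L unfolding scaled_laplacian_def by (intro eq_matI) auto
  then show "(\<Sum>x\<in>#laplacian_eigenvalues W. x\<^sup>2) = ?c\<^sup>2 * mat_trace (?L * ?L)"
    using sums(2) L by (simp add: mat_trace_smult[of _ n] power2_eq_square)
qed

lemma sum_mset_image_diff:
  fixes f g :: "'a \<Rightarrow> 'b :: ab_group_add"
  shows "(\<Sum>x\<in>#M. f x - g x) = (\<Sum>x\<in>#M. f x) - (\<Sum>x\<in>#M. g x)"
  by (induction M) simp_all

lemma quadratic_entropy_eq_sum_squares:
  assumes "weighted_graph n E W" "has_positive_edge E W"
  shows "quadratic_entropy W = 1 - (\<Sum>x\<in>#laplacian_eigenvalues W. x\<^sup>2)"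
proof -
  have "quadratic_entropy W
      = (\<Sum>x\<in>#laplacian_eigenvalues W. x) - (\<Sum>x\<in>#laplacian_eigenvalues W. x\<^sup>2)"
    by (simp add: quadratic_entropy_def right_diff_distrib sum_mset_image_diff power2_eq_square)
  then show ?thesis
    using scaled_laplacian_eigenvalue_sums(1)[OF assms] by simp
qed


section \<open>Entropy bounds from the spread of the nonzero eigenvalues\<close>

lemma nonneg_mset_spread_bounds:
  fixes M :: "real multiset"
  assumes a: "0 < a" and M: "\<And>x. x \<in># M \<Longrightarrow> x \<noteq> 0 \<Longrightarrow> a \<le> x \<and> x \<le> b"
  defines "m \<equiv> real (size {#x \<in># M. x > 0#})" and "s \<equiv> (\<Sum>x\<in>#M. x)"
  shows "m * a \<le> s" "s \<le> m * b"
    and "s * ln a \<le> (\<Sum>x\<in>#M. x * ln x)" "(\<Sum>x\<in>#M. x * ln x) \<le> s * ln b"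
    and "(\<Sum>x\<in>#M. x\<^sup>2) \<le> s * b"
proof -
  \<comment> \<open>All five bounds hold summand by summand, so one induction serves them together.
    A zero element adds nothing to either side; a nonzero one is positive and lies between
    \<open>a\<close> and \<open>b\<close>.\<close>
  have "m * a \<le> s \<and> s \<le> m * b \<and> s * ln a \<le> (\<Sum>x\<in>#M. x * ln x)
      \<and> (\<Sum>x\<in>#M. x * ln x) \<le> s * ln b \<and> (\<Sum>x\<in>#M. x\<^sup>2) \<le> s * b"
    using M unfolding m_def s_def
  proof (induction M)
    case (add x M)
    show ?case
    proof (cases "x = 0")
      case False
      with add.prems a have x: "a \<le> x" "x \<le> b" "0 < x" by force+
      with a have "x * ln a \<le> x * ln x" "x * ln x \<le> x * ln b" "x\<^sup>2 \<le> x * b"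
        by (simp_all add: power2_eq_square)
      with x add show ?thesis by (auto simp: algebra_simps intro!: add_mono)
    qed (use add in simp)
  qed simp
  then show "m * a \<le> s" "s \<le> m * b" "s * ln a \<le> (\<Sum>x\<in>#M. x * ln x)"
    "(\<Sum>x\<in>#M. x * ln x) \<le> s * ln b" "(\<Sum>x\<in>#M. x\<^sup>2) \<le> s * b" by auto
qed

lemma lambda_bounds:
  assumes "weighted_graph n E W" "has_positive_edge E W"
  shows "\<And>x. x \<in># laplacian_eigenvalues W \<Longrightarrow> x \<noteq> 0 \<Longrightarrow> lambda_min W \<le> x \<and> x \<le> lambda_max W"
    and "lambda_min W \<noteq> 0" and "lambda_max W > 0"
proof -
  let ?M = "laplacian_eigenvalues W"
  let ?N = "{x. x \<in># ?M \<and> x \<noteq> 0}"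
  have sum: "(\<Sum>x\<in>#?M. x) = 1"
    by (rule scaled_laplacian_eigenvalue_sums(1)[OF assms])
  have fin: "finite ?N" by simp
  \<comment> \<open>The eigenvalues sum to 1, so they cannot all be nonpositive. This makes
    \<open>?N\<close> nonempty, so that \<open>Min\<close> and \<open>Max\<close> are attained
    there.\<close>
  have "\<exists>x\<in>#?M. x > 0"
  proof (rule ccontr)
    assume "\<not> (\<exists>x\<in>#?M. x > 0)"
    then have "(\<Sum>x\<in>#?M. x) \<le> (\<Sum>x\<in>#?M. 0)"
      by (intro sum_mset_mono) (auto simp: not_less)
    with sum show False by simp
  qed
  then obtain x where x: "x \<in> ?N" "x > 0" by auto
  show "lambda_min W \<le> x \<and> x \<le> lambda_max W" if "x \<in># ?M" "x \<noteq> 0" for x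
    using fin that by (auto simp: lambda_min_def lambda_max_def)
  show "lambda_min W \<noteq> 0"
    using Min_in[OF fin] x unfolding lambda_min_def by blast
  show "lambda_max W > 0"
    using Max_ge[OF fin x(1)] x(2) by (simp add: lambda_max_def)
qed

text \<open>With unit sum, the entropy lies between \<open>- ln ?b\<close> and
  \<open>- ln ?a\<close>, and the sum of squares between 0 and \<open>?b\<close>. The count
  \<open>m\<close> enters through \<open>m * ?a \<le> 1 \<le> m * ?b\<close>.\<close>

lemma entropy_bounds:
  assumes G: "weighted_graph n E W" "has_positive_edge E W" and "lambda_min W > 0"
  defines "m \<equiv> real (num_positive_eigenvalues W)" and "r \<equiv> lambda_max W / lambda_min W"
  shows "m > 0"
    and "ln m - ln r \<le> von_neumann_entropy W" "von_neumann_entropy W \<le> ln m + ln r"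
    and "1 - r / m \<le> quadratic_entropy W" "quadratic_entropy W \<le> 1"
proof -
  let ?M = "laplacian_eigenvalues W" and ?a = "lambda_min W" and ?b = "lambda_max W"
  have b: "?b > 0" using lambda_bounds(3)[OF G] .
  note spread = nonneg_mset_spread_bounds[of ?a ?M ?b, OF assms(3) lambda_bounds(1)[OF G],
      unfolded scaled_laplacian_eigenvalue_sums(1)[OF G], folded num_positive_eigenvalues_def]
  have ma: "m * ?a \<le> 1" and mb: "1 \<le> m * ?b"
    using spread(1,2) by (simp_all add: m_def)
  then show m: "m > 0"
    using m_def by (cases "m = 0") auto
  have r: "r > 0" using b assms(3) by (simp add: r_def)
  \<comment> \<open>\<open>?b\<close> equals \<open>r * ?a\<close>, and
    \<open>?a \<le> 1 / m\<close>.\<close>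
  have "?b \<le> r / m"
    using ma m b assms(3) by (simp add: r_def field_simps)
  then have "ln ?b \<le> ln r - ln m"
    using b m r ln_mono[of ?b "r / m"] by (simp add: ln_div)
  then show "ln m - ln r \<le> von_neumann_entropy W"
    using spread(4) by (simp add: von_neumann_entropy_def)
  \<comment> \<open>\<open>?a\<close> equals \<open>?b / r\<close>, and
    \<open>?b \<ge> 1 / m\<close>.\<close>
  have "1 / (m * r) \<le> ?a"
    using mb m b assms(3) by (simp add: r_def field_simps)
  then have "- (ln m + ln r) \<le> ln ?a"
    using assms(3) m r ln_mono[of "1 / (m * r)" ?a] by (simp add: ln_div ln_mult)
  then show "von_neumann_entropy W \<le> ln m + ln r"
    using spread(3) by (simp add: von_neumann_entropy_def)
  show "1 - r / m \<le> quadratic_entropy W"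
    using spread(5) \<open>?b \<le> r / m\<close> by (simp add: quadratic_entropy_eq_sum_squares[OF G])
  have "(\<Sum>x\<in>#?M. 0) \<le> (\<Sum>x\<in>#?M. x\<^sup>2)"
    by (intro sum_mset_mono) simp
  then show "quadratic_entropy W \<le> 1"
    by (simp add: quadratic_entropy_eq_sum_squares[OF G])
qed

section \<open>Asymptotics of the normalized entropy\<close>

lemma entropy_gap_tendsto_0:
  assumes G: "\<And>n. n \<ge> n\<^sub>0 \<Longrightarrow> weighted_graph n (E n) (W n) \<and> has_positive_edge (E n) (W n)"
    and num: "(\<lambda>n. real (num_positive_eigenvalues (W n))) \<sim>[sequentially] (\<lambda>n. real n)"
    and gap: "(\<lambda>n. lambda_max (W n)) \<sim>[sequentially] (\<lambda>n. lambda_min (W n))"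
  shows "(\<lambda>n. von_neumann_entropy (W n) / ln (real n) - quadratic_entropy (W n)) \<longlonglongrightarrow> 0"
proof -
  define m where "m n = real (num_positive_eigenvalues (W n))" for n
  define r where "r n = lambda_max (W n) / lambda_min (W n)" for n
  \<comment> \<open>Asymptotic equivalence assigns the value 1 to the ratio 0/0. Since
    \<open>lambda_min\<close> is nonzero from \<open>n\<^sub>0\<close> on, the ratio is eventually
    the plain quotient \<open>r\<close>.\<close>
  have "\<forall>\<^sub>F n in sequentially.
      (if lambda_max (W n) = 0 \<and> lambda_min (W n) = 0 then 1
       else lambda_max (W n) / lambda_min (W n)) = r n"
    using eventually_ge_at_top[of n\<^sub>0]
    by eventually_elim (use G lambda_bounds(2) in \<open>auto simp: r_def\<close>)
  with asymp_equivD[OF gap] have r: "r \<longlonglongrightarrow> 1"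
    by (rule Lim_transform_eventually)
  \<comment> \<open>Here \<open>n \<ge> 2\<close> makes \<open>ln (real n)\<close> positive, and
    \<open>r n > 0\<close> makes \<open>lambda_min\<close> positive because
    \<open>lambda_max\<close> is.\<close>
  have ev: "\<forall>\<^sub>F n in sequentially. n \<ge> n\<^sub>0 \<and> n \<ge> 2 \<and> r n > 0"
    using eventually_ge_at_top[of n\<^sub>0] eventually_ge_at_top[of 2] order_tendstoD(1)[OF r, of 0]
    by (auto elim: eventually_elim2 simp: eventually_conj_iff)
  have pos: "lambda_min (W n) > 0" if "n \<ge> n\<^sub>0" "r n > 0" for n
    using lambda_bounds(3)[of n "E n" "W n"] G that by (auto simp: r_def zero_less_divide_iff)
  have "\<forall>\<^sub>F n in sequentially. (if m n = 0 \<and> real n = 0 then 1 else m n / real n) = m n / real n"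
    using eventually_gt_at_top[of 0] by eventually_elim auto
  with asymp_equivD[OF num[folded m_def]] have m_n: "(\<lambda>n. m n / real n) \<longlonglongrightarrow> 1"
    by (rule Lim_transform_eventually)
  have inv_n: "(\<lambda>n. 1 / real n) \<longlonglongrightarrow> 0" and inv_ln: "(\<lambda>n. 1 / ln (real n)) \<longlonglongrightarrow> 0"
    by real_asymp+
  have "(\<lambda>n. r n / (m n / real n) * (1 / real n)) \<longlonglongrightarrow> 1 / 1 * 0"
    by (intro tendsto_intros r m_n inv_n) simp
  moreover have "\<forall>\<^sub>F n in sequentially. r n / (m n / real n) * (1 / real n) = r n / m n"
    using eventually_gt_at_top[of 0] by eventually_elim auto
  ultimately have rm: "(\<lambda>n. r n / m n) \<longlonglongrightarrow> 0"
    using Lim_transform_eventually by fastforce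
  have lnr: "(\<lambda>n. ln (r n)) \<longlonglongrightarrow> 0" and ln_mn: "(\<lambda>n. ln (m n / real n)) \<longlonglongrightarrow> 0"
    using tendsto_ln[OF r] tendsto_ln[OF m_n] by simp_all
  \<comment> \<open>The envelopes come from \<open>ln m = ln n + ln (m / n)\<close>: dividing the
    entropy bounds by \<open>ln n\<close> leaves \<open>1\<close> plus a vanishing term. The upper
    one also absorbs the bound \<open>r / m\<close> on \<open>1 - Q\<close>; the lower one uses
    \<open>Q \<le> 1\<close>.\<close>
  have lower: "(\<lambda>n. (ln (m n / real n) - ln (r n)) * (1 / ln (real n))) \<longlonglongrightarrow> 0"
    and upper: "(\<lambda>n. (ln (m n / real n) + ln (r n)) * (1 / ln (real n)) + r n / m n) \<longlonglongrightarrow> 0"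
    using tendsto_mult[OF tendsto_diff[OF ln_mn lnr] inv_ln]
      tendsto_add[OF tendsto_mult[OF tendsto_add[OF ln_mn lnr] inv_ln] rm] by simp_all
  have bounds: "(ln (m n / real n) - ln (r n)) * (1 / ln (real n))
        \<le> von_neumann_entropy (W n) / ln (real n) - quadratic_entropy (W n)"
      "von_neumann_entropy (W n) / ln (real n) - quadratic_entropy (W n)
        \<le> (ln (m n / real n) + ln (r n)) * (1 / ln (real n)) + r n / m n"
    if "n \<ge> n\<^sub>0 \<and> n \<ge> 2 \<and> r n > 0" for n
  proof -
    have ln: "ln (real n) > 0" using that by simp
    note B = entropy_bounds[of n "E n" "W n", folded m_def r_def]
    have "m n > 0" and VQ: "ln (m n) - ln (r n) \<le> von_neumann_entropy (W n)"
      "von_neumann_entropy (W n) \<le> ln (m n) + ln (r n)"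
      "1 - r n / m n \<le> quadratic_entropy (W n)" "quadratic_entropy (W n) \<le> 1"
      using B G pos that by auto
    then have "ln (m n / real n) = ln (m n) - ln (real n)"
      using that by (simp add: ln_div)
    \<comment> \<open>Taking \<open>t\<close> to be \<open>- ln (r n)\<close> and
      \<open>ln (r n)\<close> covers both envelopes.\<close>
    with ln have eq: "(ln (m n / real n) + t) * (1 / ln (real n)) = (ln (m n) + t) / ln (real n) - 1" for t
      by (simp add: field_simps)
    have "(ln (m n) + - ln (r n)) / ln (real n) \<le> von_neumann_entropy (W n) / ln (real n)"
      "von_neumann_entropy (W n) / ln (real n) \<le> (ln (m n) + ln (r n)) / ln (real n)"
      using VQ ln by (auto intro!: divide_right_mono)
    with VQ eq[of "- ln (r n)"] eq[of "ln (r n)"]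
    show "(ln (m n / real n) - ln (r n)) * (1 / ln (real n))
        \<le> von_neumann_entropy (W n) / ln (real n) - quadratic_entropy (W n)"
      "von_neumann_entropy (W n) / ln (real n) - quadratic_entropy (W n)
        \<le> (ln (m n / real n) + ln (r n)) * (1 / ln (real n)) + r n / m n"
      by simp_all
  qed
  show ?thesis
    by (rule tendsto_sandwich[OF _ _ lower upper]) (use ev bounds in \<open>auto elim: eventually_mono\<close>)
qed

theorem proposition1:
  "(\<forall>(n::nat) (E::(nat \<times> nat) set) (W::real mat).
      weighted_graph n E W \<and> has_positive_edge E W \<longrightarrow>
      (let c = laplacian_scale W; d = diag_vec (laplacian W); u = ones_vec n in
        quadratic_entropy W = 1 - c\<^sup>2 * (d \<bullet> d + u \<bullet> (hadamard W W *\<^sub>v u))))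
   \<and>
   (\<forall>(n\<^sub>0::nat) (E::nat \<Rightarrow> (nat \<times> nat) set) (W::nat \<Rightarrow> real mat).
      (\<forall>n\<ge>n\<^sub>0. weighted_graph n (E n) (W n) \<and> has_positive_edge (E n) (W n)) \<and>
      (\<lambda>n. real (num_positive_eigenvalues (W n))) \<sim>[sequentially] (\<lambda>n. real n) \<and>
      (\<lambda>n. lambda_max (W n)) \<sim>[sequentially] (\<lambda>n. lambda_min (W n)) \<longrightarrow>
      (\<lambda>n. von_neumann_entropy (W n) / ln (real n) - quadratic_entropy (W n)) \<longlonglongrightarrow> 0)"
proof (intro conjI allI impI)
  fix n :: nat and E :: "(nat \<times> nat) set" and W :: "real mat"
  assume "weighted_graph n E W \<and> has_positive_edge E W"
  then have G: "weighted_graph n E W" "has_positive_edge E W" by auto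
  show "let c = laplacian_scale W; d = diag_vec (laplacian W); u = ones_vec n in
        quadratic_entropy W = 1 - c\<^sup>2 * (d \<bullet> d + u \<bullet> (hadamard W W *\<^sub>v u))"
    by (simp only: Let_def quadratic_entropy_eq_sum_squares[OF G]
        scaled_laplacian_eigenvalue_sums(2)[OF G] mat_trace_laplacian_square[OF G(1)])
next
  fix n\<^sub>0 :: nat and E :: "nat \<Rightarrow> (nat \<times> nat) set" and W :: "nat \<Rightarrow> real mat"
  assume "(\<forall>n\<ge>n\<^sub>0. weighted_graph n (E n) (W n) \<and> has_positive_edge (E n) (W n)) \<and>
      (\<lambda>n. real (num_positive_eigenvalues (W n))) \<sim>[sequentially] (\<lambda>n. real n) \<and>
      (\<lambda>n. lambda_max (W n)) \<sim>[sequentially] (\<lambda>n. lambda_min (W n))"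
  then show "(\<lambda>n. von_neumann_entropy (W n) / ln (real n) - quadratic_entropy (W n)) \<longlonglongrightarrow> 0"
    using entropy_gap_tendsto_0[of n\<^sub>0 E W] by blast
qed

end
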